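(* Let $\nabla$ be a cl-connection on $\mathbb{R}^2$ determined by $(W,m,n)$, where $W=(\cos\theta_0,\sin\theta_0)$, and let $\lambda>0$ be a constant. Let $\gamma:I\to\mathbb{R}^2$ be a smooth curve parametrized by arc length such that $m+n=\lambda$ along $\gamma$ and whose tangential curvature with respect to $\nabla$ is $\kappa_t(s)=1/s$, for $s>0$. Then the domain of definition of the curve is restricted to $s\ge 1/\lambda$, and up to rigid translations $\gamma(s)$ is given, for a suitable choice of the signs, by $$\gamma(s)=R_{\theta_0}\left(\pm\frac{\log(s)}{\lambda},\ \pm\frac{1}{\lambda}\left[\sqrt{\lambda^2s^2-1}-\arccos\left(\frac{1}{\lambda s}\right)\right]\right).$$
   Context: $\langle\cdot,\cdot\rangle$ is the Euclidean metric on $\mathbb{R}^2$ and $\nabla^0$ its Levi-Civita connection. Let $W$ be a constant unit vector field on $\mathbb{R}^2$ and let $m,n:\mathbb{R}^2\to\mathbb{R}$ be smooth functions, not both identically zero. The canonical linear connection (cl-connection) determined by $(W,m,n)$ is $$\nabla_XY=\nabla^0_XY+m\langle W,Y\rangle X+n\langle X,Y\rangle W .$$ For a smooth curve $\gamma$ parametrized by arc length with unit tangent $T=\gamma'$, the tangential curvature of $\gamma$ with respect to $\nabla$ is $\kappa_t=(m+n)\langle W,T\rangle$, where $m,n$ are evaluated along $\gamma$. $R_\theta$ denotes the rotation of $\mathbb{R}^2$ about the origin by the angle $\theta$. *)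

theory Defs
  imports "HOL-Analysis.Analysis"
begin

text \<open>
  \<open>f\<close> is of class \<open>C^k\<close> on \<open>S\<close>: all directional derivatives up to order \<open>k\<close> exist and are
  continuous.  Derivatives are taken within \<open>S\<close>, so the notion is the usual one when \<open>S\<close> is
  open and when \<open>S\<close> is a nondegenerate interval of reals (one-sided derivatives at an endpoint
  belonging to \<open>S\<close>); these are the only cases in which it is meant to be used.
\<close>
primrec Ck_on :: "nat \<Rightarrow> ('a::euclidean_space \<Rightarrow> 'b::real_normed_vector) \<Rightarrow> 'a set \<Rightarrow> bool"
  where
    "Ck_on 0 f S \<longleftrightarrow> continuous_on S f"
  | "Ck_on (Suc k) f S \<longleftrightarrow>
       f differentiable_on S \<and>
       (\<forall>v. Ck_on k (\<lambda>x. frechet_derivative f (at x within S) v) S)"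

definition smooth_on :: "('a::euclidean_space \<Rightarrow> 'b::real_normed_vector) \<Rightarrow> 'a set \<Rightarrow> bool"
  where "smooth_on f S \<longleftrightarrow> (\<forall>k. Ck_on k f S)"

type_synonym vfield = "real^2 \<Rightarrow> real^2"

text \<open>The Levi-Civita connection of the Euclidean metric: \<open>\<nabla>\<^sup>0\<^sub>X Y\<close> is the derivative of \<open>Y\<close>
  in the direction \<open>X\<close>.\<close>
definition flat_connection :: "vfield \<Rightarrow> vfield \<Rightarrow> vfield"
  where "flat_connection X Y = (\<lambda>p. frechet_derivative Y (at p) (X p))"

text \<open>\<open>D X Y\<close> stands for \<open>\<nabla>\<^sub>X Y\<close>; its values matter only on smooth vector fields.\<close>
definition is_cl_connection ::
  "(vfield \<Rightarrow> vfield \<Rightarrow> vfield) \<Rightarrow> vfield \<Rightarrow> (real^2 \<Rightarrow> real) \<Rightarrow> (real^2 \<Rightarrow> real) \<Rightarrow> bool"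
  where "is_cl_connection D W m n \<longleftrightarrow>
    W constant_on UNIV \<and> (\<forall>p. norm (W p) = 1) \<and>
    smooth_on m UNIV \<and> smooth_on n UNIV \<and>
    \<not> ((\<forall>p. m p = 0) \<and> (\<forall>p. n p = 0)) \<and>
    (\<forall>X Y. smooth_on X UNIV \<longrightarrow> smooth_on Y UNIV \<longrightarrow>
      (\<forall>p. D X Y p = flat_connection X Y p
             + (m p * (W p \<bullet> Y p)) *\<^sub>R X p + (n p * (X p \<bullet> Y p)) *\<^sub>R W p))"

definition unit_speed_curve :: "real set \<Rightarrow> (real \<Rightarrow> real^2) \<Rightarrow> bool"
  where "unit_speed_curve I \<gamma> \<longleftrightarrow>
    is_interval I \<and> interior I \<noteq> {} \<and> smooth_on \<gamma> I \<and>
    (\<forall>s\<in>I. norm (vector_derivative \<gamma> (at s within I)) = 1)"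

text \<open>The tangential curvature, with respect to the cl-connection determined by \<open>(W, m, n)\<close>, of
  a curve \<open>\<gamma>\<close> that is parametrized by arc length on \<open>I\<close>.  The connection determines
  \<open>(m + n) W\<close>, so this depends on \<open>(W, m, n)\<close> only through the connection.\<close>
definition tangential_curvature ::
  "vfield \<Rightarrow> (real^2 \<Rightarrow> real) \<Rightarrow> (real^2 \<Rightarrow> real) \<Rightarrow> real set \<Rightarrow> (real \<Rightarrow> real^2) \<Rightarrow> real \<Rightarrow> real"
  where "tangential_curvature W m n I \<gamma> s =
    (m (\<gamma> s) + n (\<gamma> s)) * (W (\<gamma> s) \<bullet> vector_derivative \<gamma> (at s within I))"

definition rotation2 :: "real \<Rightarrow> real^2 \<Rightarrow> real^2"
  where "rotation2 \<theta> p =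
    vector [cos \<theta> * p$1 - sin \<theta> * p$2, sin \<theta> * p$1 + cos \<theta> * p$2]"

end

theory Submission
  imports Defs
begin

text \<open>
  Along the curve the curvature condition says \<open>\<langle>W, T\<rangle> = 1 / (lam * s)\<close>.  Undoing the rotation
  by \<open>\<theta>\<^sub>0\<close> turns \<open>W\<close> into the first coordinate vector, so the rotated curve \<open>\<eta>\<close> has a velocity
  whose first component is \<open>1 / (lam * s)\<close>.  Unit speed bounds this component by \<open>1\<close>, which is
  the restriction \<open>s \<ge> 1 / lam\<close>, and forces the square of the second component to be
  \<open>1 - 1 / (lam * s)\<^sup>2\<close>.

  Both coordinates are now found by integration.  The first is \<open>ln s / lam\<close> up to a constant.
  For the second, its derivative is continuous and vanishes at most at \<open>s = 1 / lam\<close>; this is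
  the least value that the parameter can take, so removing it leaves an interval, on which the
  derivative keeps one sign (\<open>continuous_nonzero_constant_sign\<close>).  Up to that sign it is the
  derivative of an explicit primitive (\<open>DERIV_sqrt_minus_arccos\<close>).  At \<open>s = 1 / lam\<close> the chain
  rule does not apply to this primitive, because the square root and the arccosine have
  infinite slope at the values reached there; but the primitive is continuous, and for
  continuous functions one exceptional point does not affect uniqueness of primitives
  (\<open>equal_derivatives_differ_by_constant\<close>).
\<close>

section \<open>Calculus on intervals\<close>

lemma at_within_interval_nontrivial:
  fixes I :: "real set"
  assumes "is_interval I" "interior I \<noteq> {}" "s \<in> I"
  shows "at s within I \<noteq> bot"
proof -
  have "\<not> (\<exists>x. I = {x})"
    using assms(2) by auto
  then have "s islimpt I"
    using assms connected_imp_perfect is_interval_connected by blast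
  then show ?thesis
    by (simp add: trivial_limit_within)
qed

text \<open>
  Smoothness is phrased through the Frechet derivative within \<open>I\<close>.  Evaluated at \<open>1\<close> it is the
  velocity, because derivatives within a nondegenerate interval are unique.
\<close>
lemma smooth_on_continuous_velocity:
  fixes f :: "real \<Rightarrow> 'b::real_normed_vector"
  assumes "is_interval I" "interior I \<noteq> {}" "smooth_on f I"
  shows "\<And>s. s \<in> I \<Longrightarrow> (f has_vector_derivative vector_derivative f (at s within I)) (at s within I)"
    and "continuous_on I (\<lambda>s. vector_derivative f (at s within I))"
proof -
  have "Ck_on (Suc 0) f I"
    using assms(3) by (simp only: smooth_on_def)
  then have diff: "f differentiable_on I"
    and cont: "continuous_on I (\<lambda>s. frechet_derivative f (at s within I) 1)"
    by auto
  show hvd: "(f has_vector_derivative vector_derivative f (at s within I)) (at s within I)"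
    if "s \<in> I" for s
    using diff that by (simp add: differentiable_on_def vector_derivative_works)
  have "frechet_derivative f (at s within I) 1 = vector_derivative f (at s within I)"
    if s: "s \<in> I" for s
  proof (rule vector_derivative_unique_within)
    show "at s within I \<noteq> bot"
      using at_within_interval_nontrivial assms s by blast
    have "(f has_derivative frechet_derivative f (at s within I)) (at s within I)"
      using diff s by (simp add: differentiable_on_def frechet_derivative_works)
    moreover from this have "linear (frechet_derivative f (at s within I))"
      by (rule has_derivative_linear)
    then have "frechet_derivative f (at s within I) h = h *\<^sub>R frechet_derivative f (at s within I) 1" for h
      using linear_scale[of "frechet_derivative f (at s within I)" h 1] by simp
    then have "frechet_derivative f (at s within I) = (\<lambda>h. h *\<^sub>R frechet_derivative f (at s within I) 1)"
      by (rule ext)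
    ultimately show "(f has_vector_derivative frechet_derivative f (at s within I) 1) (at s within I)"
      by (simp only: has_vector_derivative_def)
    show "(f has_vector_derivative vector_derivative f (at s within I)) (at s within I)"
      using hvd s .
  qed
  then show "continuous_on I (\<lambda>s. vector_derivative f (at s within I))"
    using cont by (simp cong: continuous_on_cong)
qed

text \<open>
  The finite exceptional set \<open>K\<close> serves for an endpoint of \<open>I\<close> at which only continuity is known.
\<close>
lemma equal_derivatives_differ_by_constant:
  fixes f g :: "real \<Rightarrow> real"
  assumes "is_interval I" "finite K" "continuous_on I f" "continuous_on I g"
    and f: "\<And>s. s \<in> I - K \<Longrightarrow> (f has_field_derivative h s) (at s within I)"
    and g: "\<And>s. s \<in> I - K \<Longrightarrow> (g has_field_derivative h s) (at s within I)"
  shows "\<exists>c. \<forall>s\<in>I. f s = c + g s"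
proof (cases "I = {}")
  case False
  then obtain a where a: "a \<in> I" by auto
  have "f s - g s = f a - g a" if "s \<in> I" for s
  proof (rule has_derivative_zero_unique_strong_convex[of I K "\<lambda>s. f s - g s" a])
    fix t assume "t \<in> I - K"
    then have "((\<lambda>s. f s - g s) has_field_derivative h t - h t) (at t within I)"
      by (intro DERIV_diff f g)
    then show "((\<lambda>s. f s - g s) has_derivative (\<lambda>h. 0)) (at t within I)"
      by (simp add: has_field_derivative_def lambda_zero[symmetric])
  qed (use assms a that in \<open>auto intro: continuous_on_diff simp: is_interval_convex_1\<close>)
  then show ?thesis
    by (intro exI[of _ "f a - g a"]) (auto simp: algebra_simps)
qed auto

lemma continuous_nonzero_constant_sign:
  fixes v :: "real \<Rightarrow> real"
  assumes "is_interval J" "continuous_on J v" "\<And>s. s \<in> J \<Longrightarrow> v s \<noteq> 0"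
  shows "\<exists>\<epsilon>\<in>{1, -1}. \<forall>s\<in>J. v s = \<epsilon> * \<bar>v s\<bar>"
proof -
  have "connected (v ` J)"
    using assms by (simp add: connected_continuous_image is_interval_connected)
  then have iv: "is_interval (v ` J)"
    by (simp add: is_interval_connected_1)
  have "(\<forall>s\<in>J. v s > 0) \<or> (\<forall>s\<in>J. v s < 0)"
  proof (rule ccontr)
    assume "\<not> ?thesis"
    then obtain s t where "s \<in> J" "t \<in> J" "v s \<le> 0" "v t \<ge> 0"
      by force
    then have "0 \<in> v ` J"
      using iv unfolding is_interval_1 by blast
    then show False
      using assms(3) by force
  qed
  then show ?thesis
    by (auto simp: abs_if)
qed

section \<open>The explicit primitive\<close>

text \<open>
  The derivative of the square root is \<open>lam\<^sup>2 * s / r\<close> and that of the arccosine is \<open>1 / (s * r)\<close>,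
  where \<open>r = sqrt (lam\<^sup>2 * s\<^sup>2 - 1)\<close>; their difference \<open>(lam\<^sup>2 * s\<^sup>2 - 1) / (s * r)\<close> collapses to
  \<open>r / s\<close>.
\<close>
lemma DERIV_sqrt_minus_arccos:
  fixes lam s :: real
  assumes lam: "lam > 0" and s: "s > 1 / lam"
  shows "((\<lambda>s. 1 / lam * (sqrt (lam\<^sup>2 * s\<^sup>2 - 1) - arccos (1 / (lam * s))))
           has_field_derivative sqrt (1 - (1 / (lam * s))\<^sup>2)) (at s within S)"
proof -
  define r where "r = sqrt (lam\<^sup>2 * s\<^sup>2 - 1)"
  have s0: "s > 0" using s lam by (meson divide_pos_pos less_trans zero_less_one)
  have ls: "lam * s > 1" using s lam by (simp add: field_simps)
  then have r2: "lam\<^sup>2 * s\<^sup>2 - 1 > 0"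
    by (metis power_mult_distrib one_less_power diff_gt_0_iff_gt zero_less_numeral)
  then have r: "r > 0" "r\<^sup>2 = lam\<^sup>2 * s\<^sup>2 - 1" by (auto simp: r_def)
  have u: "-1 < 1 / (lam * s)" "1 / (lam * s) < 1"
    using ls by (auto simp: field_simps intro: less_trans[of _ 0])
  have "1 - (1 / (lam * s))\<^sup>2 = (r / (lam * s))\<^sup>2"
    using lam s0 unfolding power_divide r(2) by (simp add: field_simps)
  then have root: "sqrt (1 - (1 / (lam * s))\<^sup>2) = r / (lam * s)"
    using r(1) lam s0 by (simp add: real_sqrt_abs)
  have "((\<lambda>s. sqrt (lam\<^sup>2 * s\<^sup>2 - 1)) has_field_derivative lam\<^sup>2 * s / r) (at s within S)"
    by (rule derivative_eq_intros refl | use r2 in \<open>simp add: r_def field_simps\<close>)+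
  moreover have "((\<lambda>s. arccos (1 / (lam * s))) has_field_derivative 1 / (s * r)) (at s within S)"
  proof -
    have "((\<lambda>s. 1 / (lam * s)) has_field_derivative - (1 / (lam * s\<^sup>2))) (at s within S)"
      by (rule derivative_eq_intros refl
          | use lam s0 in \<open>simp add: field_simps power2_eq_square\<close>)+
    from DERIV_chain2[OF DERIV_arccos[OF u] this]
    show ?thesis
      unfolding root using lam s0 r(1) by (simp add: field_simps power2_eq_square)
  qed
  ultimately have "((\<lambda>s. 1 / lam * (sqrt (lam\<^sup>2 * s\<^sup>2 - 1) - arccos (1 / (lam * s))))
      has_field_derivative 1 / lam * (lam\<^sup>2 * s / r - 1 / (s * r))) (at s within S)"
    by (intro DERIV_cmult DERIV_diff)
  moreover have "1 / lam * (lam\<^sup>2 * s / r - 1 / (s * r)) = r\<^sup>2 / (lam * s * r)"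
    unfolding r(2) using lam s0 r(1) by (simp add: field_simps power2_eq_square)
  moreover have "r\<^sup>2 / (lam * s * r) = r / (lam * s)"
    using r(1) by (simp add: power2_eq_square)
  ultimately show ?thesis
    by (simp only: root)
qed

lemma continuous_on_sqrt_minus_arccos:
  fixes lam :: real
  assumes lam: "lam > 0" and S: "S \<subseteq> {1 / lam..}"
  shows "continuous_on S (\<lambda>s. 1 / lam * (sqrt (lam\<^sup>2 * s\<^sup>2 - 1) - arccos (1 / (lam * s))))"
proof -
  have "lam * s \<noteq> 0 \<and> -1 \<le> 1 / (lam * s) \<and> 1 / (lam * s) \<le> 1" if "s \<in> S" for s
  proof -
    have ls: "lam * s \<ge> 1"
      using that S lam by (auto simp: field_simps)
    then have "lam * s \<noteq> 0"
      by linarith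
    moreover have "0 \<le> 1 / (lam * s)"
      using ls by simp
    moreover have "1 / (lam * s) \<le> 1"
      using ls by (intro divide_le_eq_1_pos[THEN iffD2]) linarith+
    ultimately show ?thesis
      by linarith
  qed
  then show ?thesis
    by (intro continuous_on_mult continuous_on_diff continuous_on_arccos continuous_on_divide
        continuous_on_real_sqrt continuous_on_power continuous_on_const continuous_on_id) auto
qed

section \<open>Rotations of the plane\<close>

lemma rotation2_nth:
  "rotation2 \<theta> p $ 1 = cos \<theta> * p$1 - sin \<theta> * p$2"
  "rotation2 \<theta> p $ 2 = sin \<theta> * p$1 + cos \<theta> * p$2"
  by (simp_all add: rotation2_def)

lemma bounded_linear_rotation2: "bounded_linear (rotation2 \<theta>)"
  by (intro linear_conv_bounded_linear[THEN iffD1] linearI)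
     (simp_all add: vec_eq_iff forall_2 rotation2_nth algebra_simps)

lemma rotation2_inverse: "rotation2 \<theta> (rotation2 (- \<theta>) p) = p"
proof -
  have "cos \<theta> * (cos \<theta> * x + sin \<theta> * y) - sin \<theta> * (cos \<theta> * y - sin \<theta> * x) = x"
       "sin \<theta> * (cos \<theta> * x + sin \<theta> * y) + cos \<theta> * (cos \<theta> * y - sin \<theta> * x) = y" for x y
    using sin_cos_squared_add[of \<theta>] by algebra+
  then show ?thesis
    by (simp add: vec_eq_iff forall_2 rotation2_nth)
qed

lemma norm_vec2_power2: "(norm (p :: real^2))\<^sup>2 = (p$1)\<^sup>2 + (p$2)\<^sup>2"
  unfolding power2_norm_eq_inner by (simp add: inner_vec_def sum_2 power2_eq_square)

lemma norm_rotation2: "norm (rotation2 \<theta> p) = norm p"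
proof -
  have "(norm (rotation2 \<theta> p))\<^sup>2 = (norm p)\<^sup>2"
    unfolding norm_vec2_power2 rotation2_nth using sin_cos_squared_add[of \<theta>] by algebra
  then show ?thesis
    by simp
qed

section \<open>Curves with prescribed angle to a constant field\<close>

text \<open>
  The case in which the constant field is the first coordinate vector: the two coordinates of
  the curve are integrated separately.
\<close>
lemma unit_speed_curve_from_first_velocity:
  fixes \<eta> T :: "real \<Rightarrow> real^2" and lam :: real
  assumes I: "is_interval I" "I \<subseteq> {0<..}" and lam: "lam > 0"
    and deriv: "\<And>s. s \<in> I \<Longrightarrow> (\<eta> has_vector_derivative T s) (at s within I)"
    and cont: "continuous_on I T"
    and unit: "\<And>s. s \<in> I \<Longrightarrow> norm (T s) = 1"
    and first: "\<And>s. s \<in> I \<Longrightarrow> T s $ 1 = 1 / (lam * s)"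
  shows "I \<subseteq> {1 / lam..}"
    and "\<exists>\<epsilon>\<in>{1, -1}. \<exists>c. \<forall>s\<in>I. \<eta> s = c + vector [ln s / lam,
           \<epsilon> * (1 / lam * (sqrt (lam\<^sup>2 * s\<^sup>2 - 1) - arccos (1 / (lam * s))))]"
proof -
  define F where "F = (\<lambda>s. 1 / lam * (sqrt (lam\<^sup>2 * s\<^sup>2 - 1) - arccos (1 / (lam * s))))"
  have second: "(T s $ 2)\<^sup>2 = 1 - (1 / (lam * s))\<^sup>2" if "s \<in> I" for s
    using norm_vec2_power2[of "T s"] unit[OF that] first[OF that] by simp
  show bound: "I \<subseteq> {1 / lam..}"
  proof
    fix s assume s: "s \<in> I"
    have "\<bar>1 / (lam * s)\<bar> \<le> 1"
      using component_le_norm_cart[of "T s" 1] unit[OF s] first[OF s] by simp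
    then show "s \<in> {1 / lam..}"
      using s I lam by (auto simp: field_simps)
  qed
  have comp: "((\<lambda>s. \<eta> s $ i) has_field_derivative T s $ i) (at s within I)" if "s \<in> I" for s i
    using bounded_linear.has_vector_derivative[OF bounded_linear_vec_nth deriv[OF that]]
    by (simp add: has_real_derivative_iff_has_vector_derivative)
  then have comp_cont: "continuous_on I (\<lambda>s. \<eta> s $ i)" for i
    by (meson DERIV_continuous_on)

  have "\<exists>c. \<forall>s\<in>I. \<eta> s $ 1 = c + ln s / lam"
  proof (rule equal_derivatives_differ_by_constant[where K = "{}" and h = "\<lambda>s. T s $ 1"])
    fix s assume s: "s \<in> I - {}"
    then have "s > 0" using I by auto
    then show "((\<lambda>s. ln s / lam) has_field_derivative T s $ 1) (at s within I)"
      using first[of s] s lam by (auto intro!: derivative_eq_intros)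
  qed (use I lam comp comp_cont in \<open>auto intro!: continuous_intros\<close>)
  then obtain c1 where c1: "\<And>s. s \<in> I \<Longrightarrow> \<eta> s $ 1 = c1 + ln s / lam"
    by blast

  \<comment> \<open>Only the left endpoint of \<open>I\<close> can be removed here, so \<open>?J\<close> is still an interval.\<close>
  let ?J = "I - {1 / lam}"
  have J: "?J = I \<inter> {1 / lam<..}"
    using bound by force
  have gt: "1 / (lam * s) < 1" "1 / (lam * s) > 0" if "s \<in> ?J" for s
  proof -
    have "s > 0" "s > 1 / lam" using that J I by auto
    then show "1 / (lam * s) < 1" "1 / (lam * s) > 0"
      using lam by (auto simp: field_simps)
  qed
  have "\<exists>\<epsilon>\<in>{1, -1}. \<forall>s\<in>?J. T s $ 2 = \<epsilon> * \<bar>T s $ 2\<bar>"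
  proof (rule continuous_nonzero_constant_sign)
    show "is_interval ?J"
      unfolding J using I(1) by (intro is_interval_Int) auto
    show "continuous_on ?J (\<lambda>s. T s $ 2)"
      using cont by (intro continuous_intros) (auto intro: continuous_on_subset)
    fix s assume s: "s \<in> ?J"
    have "(1 / (lam * s))\<^sup>2 < 1"
      using gt[OF s] by (simp add: power_less_one_iff abs_square_less_1)
    then show "T s $ 2 \<noteq> 0"
      using second[of s] s by auto
  qed
  then obtain \<epsilon> :: real where eps: "\<epsilon> \<in> {1, -1}" "\<And>s. s \<in> ?J \<Longrightarrow> T s $ 2 = \<epsilon> * \<bar>T s $ 2\<bar>"
    by blast
  have "\<exists>c. \<forall>s\<in>I. \<eta> s $ 2 = c + \<epsilon> * F s"
  proof (rule equal_derivatives_differ_by_constant[where K = "{1 / lam}" and h = "\<lambda>s. T s $ 2"])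
    fix s assume s: "s \<in> ?J"
    have "T s $ 2 = \<epsilon> * sqrt (1 - (1 / (lam * s))\<^sup>2)"
      using eps(2)[OF s] second[of s] s by (metis DiffD1 real_sqrt_abs)
    moreover have "(F has_field_derivative sqrt (1 - (1 / (lam * s))\<^sup>2)) (at s within I)"
      unfolding F_def using DERIV_sqrt_minus_arccos lam s J by blast
    ultimately show "((\<lambda>s. \<epsilon> * F s) has_field_derivative T s $ 2) (at s within I)"
      by (simp add: DERIV_cmult)
    show "((\<lambda>s. \<eta> s $ 2) has_field_derivative T s $ 2) (at s within I)"
      using comp s by auto
  next
    show "continuous_on I (\<lambda>s. \<epsilon> * F s)"
      unfolding F_def
      by (intro continuous_on_mult_left continuous_on_sqrt_minus_arccos lam bound)
  qed (use I comp_cont in auto)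
  then obtain c2 where c2: "\<And>s. s \<in> I \<Longrightarrow> \<eta> s $ 2 = c2 + \<epsilon> * F s"
    by blast

  have "\<forall>s\<in>I. \<eta> s = vector [c1, c2] + vector [ln s / lam, \<epsilon> * F s]"
    using c1 c2 by (simp add: vec_eq_iff forall_2)
  with eps(1) show "\<exists>\<epsilon>\<in>{1, -1}. \<exists>c. \<forall>s\<in>I. \<eta> s = c + vector [ln s / lam,
           \<epsilon> * (1 / lam * (sqrt (lam\<^sup>2 * s\<^sup>2 - 1) - arccos (1 / (lam * s))))]"
    unfolding F_def by blast
qed

theorem theorem5p4:
  fixes D :: "vfield \<Rightarrow> vfield \<Rightarrow> vfield"
    and W :: vfield
    and m n :: "real^2 \<Rightarrow> real"
    and \<theta>\<^sub>0 lam :: real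
    and I :: "real set"
    and \<gamma> :: "real \<Rightarrow> real^2"
  assumes "is_cl_connection D W m n"
    and "W = (\<lambda>p. vector [cos \<theta>\<^sub>0, sin \<theta>\<^sub>0])"
    and "lam > 0"
    and "unit_speed_curve I \<gamma>"
    and "I \<subseteq> {0<..}"
    and "\<forall>s\<in>I. m (\<gamma> s) + n (\<gamma> s) = lam"
    and "\<forall>s\<in>I. tangential_curvature W m n I \<gamma> s = 1 / s"
  shows "I \<subseteq> {1 / lam..} \<and>
    (\<exists>\<epsilon>\<^sub>1\<in>{1, -1}. \<exists>\<epsilon>\<^sub>2\<in>{1, -1}. \<exists>c :: real^2. \<forall>s\<in>I.
      \<gamma> s = c + rotation2 \<theta>\<^sub>0
        (vector [\<epsilon>\<^sub>1 * (ln s / lam),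
                 \<epsilon>\<^sub>2 * (1 / lam * (sqrt (lam\<^sup>2 * s\<^sup>2 - 1) - arccos (1 / (lam * s))))]))"
proof -
  define T where "T = (\<lambda>s. vector_derivative \<gamma> (at s within I))"
  define R where "R = rotation2 (- \<theta>\<^sub>0)"
  have R: "bounded_linear R"
    by (simp add: R_def bounded_linear_rotation2)
  have I: "is_interval I" "interior I \<noteq> {}" "smooth_on \<gamma> I"
    and unit: "\<And>s. s \<in> I \<Longrightarrow> norm (T s) = 1"
    using assms(4) by (auto simp: unit_speed_curve_def T_def)
  note velocity = smooth_on_continuous_velocity[OF I, folded T_def]
  have deriv: "((\<lambda>s. R (\<gamma> s)) has_vector_derivative R (T s)) (at s within I)" if "s \<in> I" for s
    using bounded_linear.has_vector_derivative[OF R] velocity(1) that by (simp add: T_def)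
  have cont: "continuous_on I (\<lambda>s. R (T s))"
    using bounded_linear.continuous_on[OF R velocity(2)] .
  have first: "R (T s) $ 1 = 1 / (lam * s)" if s: "s \<in> I" for s
  proof -
    have "lam * (R (T s) $ 1) = 1 / s"
      using assms(2,6,7) s
      by (auto simp: tangential_curvature_def R_def rotation2_nth inner_vec_def sum_2 T_def)
    then show ?thesis
      using assms(3,5) s by (auto simp: field_simps)
  qed
  have "norm (R (T s)) = 1" if "s \<in> I" for s
    using unit that by (simp add: R_def norm_rotation2)
  note curve = unit_speed_curve_from_first_velocity[OF I(1) assms(5,3) deriv cont this first]
  from curve(2) obtain \<epsilon> :: real and c where eps: "\<epsilon> \<in> {1, -1}"
    and c: "\<And>s. s \<in> I \<Longrightarrow> R (\<gamma> s) = c + vector [ln s / lam,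
              \<epsilon> * (1 / lam * (sqrt (lam\<^sup>2 * s\<^sup>2 - 1) - arccos (1 / (lam * s))))]"
    by blast
  \<comment> \<open>The first sign is \<open>1\<close>, since \<open>\<langle>W, T\<rangle>\<close> is positive.\<close>
  have "\<gamma> s = rotation2 \<theta>\<^sub>0 c + rotation2 \<theta>\<^sub>0 (vector [1 * (ln s / lam),
          \<epsilon> * (1 / lam * (sqrt (lam\<^sup>2 * s\<^sup>2 - 1) - arccos (1 / (lam * s))))])" if "s \<in> I" for s
  proof -
    have "\<gamma> s = rotation2 \<theta>\<^sub>0 (R (\<gamma> s))"
      by (simp add: R_def rotation2_inverse)
    then show ?thesis
      using c[OF that] linear_add[OF bounded_linear.linear[OF bounded_linear_rotation2]] by simp
  qed
  with curve(1) eps show ?thesis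
    by blast
qed

end
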